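(* Let $d,M\ge1$, let $\alpha>0$, let $\sigma\in C^2_b(\mathbb{R})$, let $(x^{(i)},y^{(i)})_{i=1}^M\subset\mathbb{R}^d\times\mathbb{R}$ be a fixed dataset, and let $\mu_0(dc,dw)$ be a mean-zero probability measure on $\mathbb{R}\times\mathbb{R}^d=\mathbb{R}^{1+d}$ (the common law of the i.i.d. initial parameters $(C_0^i,W_0^i)$) such that $C_0^i$ has compact support and $\int\|w\|\,\mu_0(dc,dw)<\infty$. Let $A\in\mathbb{R}^{M\times M}$ be the symmetric matrix with entries $$A_{ij}=\frac{\alpha}{M}\int\sigma(w\cdot x^{(i)})\sigma(w\cdot x^{(j)})\,\mu_0(dc,dw)+\frac{\alpha}{M}\int c^2\sigma'(w\cdot x^{(j)})\sigma'(w\cdot x^{(i)})\,(x^{(i)}\cdot x^{(j)})\,\mu_0(dc,dw).$$ A sufficient condition for $A$ to be positive definite is that $\sigma$ is non-polynomial and slowly increasing (i.e. $\lim_{x\to\infty}\sigma(x)/x^a=0$ for every $a>0$), that $\mu_0$ is positive when evaluated on sets of positive Lebesgue measure, and that the data samples $x^{(1)},\dots,x^{(M)}$ are in distinct directions.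
   Context: $\sigma\in C^2_b(\mathbb{R})$ means $\sigma$ is twice continuously differentiable and bounded, with bounded first and second derivatives. The measure $\mu_0$ is a measure on $\mathbb{R}^{1+d}$, the space of pairs $(c,w)$. The vectors $x^{(1)},\dots,x^{(M)}$ are "in distinct directions" (terminology of Y. Ito, Nonlinearity creates linear independence, Advances in Computational Mathematics 5, 1996, p. 192) if they are all nonzero and no two of them (with different indices) are scalar multiples of each other.
   Formalization: Positivity on all sets of positive Lebesgue measure in R^{1+d} contradicts the compact support of C_0 (take {|c|>K} x R^d), so positivity is required only of the law of W_0: μ_0(R x B)>0 for every Borel B in R^d of positive Lebesgue measure, a weaker hypothesis. *)

theory Defs
  imports "HOL-Probability.Probability" "HOL-Computational_Algebra.Polynomial"
begin

definition C2_bounded :: "(real \<Rightarrow> real) \<Rightarrow> bool" where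
  "C2_bounded f \<longleftrightarrow>
     (\<forall>t. f differentiable at t) \<and> (\<forall>t. deriv f differentiable at t) \<and>
     continuous_on UNIV (deriv (deriv f)) \<and>
     bounded (range f) \<and> bounded (range (deriv f)) \<and> bounded (range (deriv (deriv f)))"

definition non_polynomial :: "(real \<Rightarrow> real) \<Rightarrow> bool" where
  "non_polynomial f \<longleftrightarrow> \<not> (\<exists>p :: real poly. \<forall>t. f t = poly p t)"

definition slowly_increasing :: "(real \<Rightarrow> real) \<Rightarrow> bool" where
  "slowly_increasing f \<longleftrightarrow> (\<forall>a>0. ((\<lambda>t. f t / t powr a) \<longlongrightarrow> 0) at_top)"

definition distinct_directions :: "('i \<Rightarrow> 'a::real_vector) \<Rightarrow> bool" where
  "distinct_directions x \<longleftrightarrow>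
     (\<forall>i. x i \<noteq> 0) \<and> (\<forall>i j. i \<noteq> j \<longrightarrow> \<not> (\<exists>k. x i = k *\<^sub>R x j))"

definition positive_definite :: "real ^ 'n ^ 'n \<Rightarrow> bool" where
  "positive_definite A \<longleftrightarrow> transpose A = A \<and> (\<forall>v. v \<noteq> 0 \<longrightarrow> v \<bullet> (A *v v) > 0)"

definition measure_support :: "'a::topological_space measure \<Rightarrow> 'a set" where
  "measure_support \<nu> = {z. \<forall>U. open U \<and> z \<in> U \<longrightarrow> emeasure \<nu> U > 0}"

definition lebesgue_positive :: "'a::euclidean_space measure \<Rightarrow> bool" where
  "lebesgue_positive \<nu> \<longleftrightarrow>
     (\<forall>B \<in> sets borel. emeasure lborel B > 0 \<longrightarrow> emeasure \<nu> B > 0)"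

definition kernel_matrix ::
  "real \<Rightarrow> (real \<Rightarrow> real) \<Rightarrow> (real \<times> (real ^ 'd)) measure \<Rightarrow> ('m \<Rightarrow> real ^ 'd) \<Rightarrow> real ^ 'm ^ 'm" where
  "kernel_matrix \<alpha> \<sigma> \<mu> x = (\<chi> i j.
     \<alpha> / real CARD('m) * (\<integral>(c, w). \<sigma> (w \<bullet> x i) * \<sigma> (w \<bullet> x j) \<partial>\<mu>) +
     \<alpha> / real CARD('m) *
       (\<integral>(c, w). c\<^sup>2 * deriv \<sigma> (w \<bullet> x j) * deriv \<sigma> (w \<bullet> x i) * (x i \<bullet> x j) \<partial>\<mu>))"

text \<open>For a law \<open>\<mu>\<close> of \<open>(C, W)\<close>, the marginals \<open>distr \<mu> borel fst\<close> and
  \<open>distr \<mu> borel snd\<close> are the laws of \<open>C\<close> and \<open>W\<close>. Positivity of \<open>\<mu>\<close> on all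
  sets of positive Lebesgue measure in the full space of pairs cannot hold when \<open>C\<close> has compact
  support (second lemma below), so positivity is imposed on the law of \<open>W\<close>; that is, on the sets
  \<open>UNIV \<times> B\<close> with \<open>B\<close> of positive Lebesgue measure. This is implied by positivity on the
  full space (first lemma).\<close>

lemma lebesgue_positive_imp_marginal:
  fixes \<mu> :: "(real \<times> 'a::euclidean_space) measure"
  assumes [measurable_cong]: "sets \<mu> = sets borel" and pos: "lebesgue_positive \<mu>"
  shows "lebesgue_positive (distr \<mu> borel snd)"
  unfolding lebesgue_positive_def
proof (intro ballI impI)
  fix B :: "'a set"
  assume [measurable]: "B \<in> sets borel" and B: "emeasure lborel B > 0"
  have sp: "space \<mu> = UNIV"
    using sets_eq_imp_space_eq[OF assms(1)] by simp
  have meas: "snd \<in> borel_measurable \<mu>"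
    unfolding measurable_cong_sets[OF assms(1) refl]
    by (intro borel_measurable_continuous_onI continuous_intros)
  have eq: "snd -` B \<inter> space \<mu> = UNIV \<times> B"
    by (auto simp: sp)
  have "emeasure lborel ((UNIV :: real set) \<times> B) = emeasure lborel (UNIV :: real set) * emeasure lborel B"
    by (simp add: lborel_prod[symmetric] lborel.emeasure_pair_measure_Times)
  then have "emeasure lborel ((UNIV :: real set) \<times> B) > 0"
    using B by (simp add: emeasure_lborel_UNIV ennreal_zero_less_mult_iff)
  moreover have "(UNIV :: real set) \<times> B \<in> sets borel"
    by (simp add: borel_prod[symmetric])
  ultimately have "emeasure \<mu> (UNIV \<times> B) > 0"
    using pos unfolding lebesgue_positive_def by blast
  then show "emeasure (distr \<mu> borel snd) B > 0"
    by (subst emeasure_distr) (simp_all add: eq meas)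
qed

lemma lebesgue_positive_imp_not_compact_support:
  fixes \<mu> :: "(real \<times> 'a::euclidean_space) measure"
  assumes "sets \<mu> = sets borel" and pos: "lebesgue_positive \<mu>"
  shows "\<not> compact (measure_support (distr \<mu> borel fst))"
proof -
  have sp: "space \<mu> = UNIV"
    using sets_eq_imp_space_eq[OF assms(1)] by simp
  have meas: "fst \<in> borel_measurable \<mu>"
    unfolding measurable_cong_sets[OF assms(1) refl]
    by (intro borel_measurable_continuous_onI continuous_intros)
  have "measure_support (distr \<mu> borel fst) = UNIV"
    unfolding measure_support_def
  proof (intro set_eqI iffI UNIV_I CollectI allI impI)
    fix z :: real and U assume U: "open U \<and> z \<in> U"
    have eq: "fst -` U \<inter> space \<mu> = U \<times> UNIV"
      by (auto simp: sp)
    have "open (U \<times> (UNIV :: 'a set))" "U \<times> (UNIV :: 'a set) \<noteq> {}"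
      using U by (auto intro: open_Times)
    then have "emeasure lborel (U \<times> (UNIV :: 'a set)) > 0"
      using open_not_negligible[of "U \<times> (UNIV :: 'a set)"]
        negligible_iff_emeasure0[of "U \<times> (UNIV :: 'a set)"]
      by (auto simp: zero_less_iff_neq_zero)
    then have "emeasure \<mu> (U \<times> UNIV) > 0"
      using pos borel_open[OF \<open>open (U \<times> (UNIV :: 'a set))\<close>]
      unfolding lebesgue_positive_def by blast
    then show "emeasure (distr \<mu> borel fst) U > 0"
      using U by (subst emeasure_distr) (simp_all add: eq meas)
  qed
  then show ?thesis
    using not_bounded_UNIV[where 'a = real] compact_imp_bounded by metis
qed

end

theory Submission
  imports Defs
begin

text \<open>For a vector \<open>v\<close>, \<open>v \<bullet> A v\<close> is \<open>\<alpha> / M\<close> times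
  \<open>\<integral> (\<Sum>i. v i * \<sigma> (w \<bullet> x i))\<^sup>2 + \<integral> c\<^sup>2 * (norm (\<Sum>i. (v i * \<sigma>' (w \<bullet> x i)) *\<^sub>R x i))\<^sup>2\<close>,
  so if it is not positive, then by continuity \<open>(\<Sum>i. v i * \<sigma> (w \<bullet> x i)) = 0\<close> for every \<open>w\<close>.
  Moving \<open>w\<close> in a direction orthogonal to \<open>x i\<close> but not to \<open>x k\<close> and taking differences
  eliminates the \<open>i\<close>-th summand. Eliminating all \<open>i \<noteq> k\<close> shows that an iterated difference of
  \<open>v k * \<sigma>\<close> with an arbitrary step vanishes; for a bounded function the first difference then
  vanishes as well, so \<open>\<sigma>\<close> is constant unless \<open>v k = 0\<close>.\<close>

lemma bounded_second_difference_zero: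
  fixes f :: "real \<Rightarrow> real"
  assumes bdd: "bounded (range f)"
    and D2: "\<And>t. f (t + h + h) - f (t + h) = f (t + h) - f t"
  shows "f (t + h) = f t"
proof (rule ccontr)
  assume ne: "f (t + h) \<noteq> f t"
  let ?c = "f (t + h) - f t"
  have step: "f (t + of_nat (Suc n) * h) - f (t + of_nat n * h) = ?c" for n
  proof (induction n)
    case (Suc n)
    have "f (t + of_nat (Suc (Suc n)) * h) - f (t + of_nat (Suc n) * h)
        = f (t + of_nat (Suc n) * h) - f (t + of_nat n * h)"
      using D2[of "t + of_nat n * h"] by (simp add: algebra_simps)
    with Suc.IH show ?case by simp
  qed simp
  have lin: "f (t + of_nat n * h) = f t + of_nat n * ?c" for n
  proof (induction n)
    case (Suc n)
    then show ?case using step[of n] by (simp add: algebra_simps)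
  qed simp
  obtain B where B: "\<And>s. \<bar>f s\<bar> \<le> B"
    using bdd by (auto simp: bounded_iff)
  obtain n where n: "2 * B < of_nat n * \<bar>?c\<bar>"
    using ex_less_of_nat_mult[of "\<bar>?c\<bar>"] ne by auto
  have "of_nat n * \<bar>?c\<bar> = \<bar>f (t + of_nat n * h) - f t\<bar>"
    by (simp add: lin abs_mult)
  also have "\<dots> \<le> 2 * B"
    using B[of "t + of_nat n * h"] B[of t] by linarith
  finally show False using n by simp
qed

lemma orthogonal_direction:
  fixes a b :: "'a::real_inner"
  assumes "\<nexists>k. b = k *\<^sub>R a" "a \<noteq> 0"
  obtains u where "u \<bullet> a = 0" "u \<bullet> b = h"
proof -
  define e where "e = b - ((b \<bullet> a) / (a \<bullet> a)) *\<^sub>R a"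
  have ea: "e \<bullet> a = 0"
    using assms(2) by (simp add: e_def inner_diff_left)
  have "e \<noteq> 0" using assms(1) by (auto simp: e_def)
  moreover have "e \<bullet> b = e \<bullet> e"
    using ea by (subst (3) e_def) (simp add: inner_diff_right)
  ultimately have "e \<bullet> b \<noteq> 0" by simp
  then have "((h / (e \<bullet> b)) *\<^sub>R e) \<bullet> a = 0" "((h / (e \<bullet> b)) *\<^sub>R e) \<bullet> b = h"
    using ea by simp_all
  then show thesis by (rule that)
qed

lemma sum_ridge_zero_imp_periodic:
  fixes x :: "'i \<Rightarrow> 'a::real_inner" and f :: "'i \<Rightarrow> real \<Rightarrow> real"
  assumes "finite S" "k \<notin> S" "x k \<noteq> 0"
    and "\<And>i. i \<in> S \<Longrightarrow> x i \<noteq> 0 \<and> (\<nexists>r. x k = r *\<^sub>R x i)"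
    and "bounded (range (f k))"
    and "\<And>w. (\<Sum>i\<in>insert k S. f i (w \<bullet> x i)) = 0"
  shows "f k (t + h) = f k t"
  using assms
proof (induction S arbitrary: f t rule: finite_induct)
  case empty
  have "f k s = 0" for s
    using empty.prems(5)[of "(s / (x k \<bullet> x k)) *\<^sub>R x k"] \<open>x k \<noteq> 0\<close> by simp
  then show ?case by simp
next
  case (insert i S)
  obtain u where u: "u \<bullet> x i = 0" "u \<bullet> x k = h"
    using orthogonal_direction[of "x k" "x i" h] insert.prems(3) by blast
  define g where "g j s = f j (s + u \<bullet> x j) - f j s" for j s
  have "g k (s + h) = g k s" for s
  proof (rule insert.IH)
    obtain B where B: "\<And>s. \<bar>f k s\<bar> \<le> B"
      using insert.prems(4) by (auto simp: bounded_iff)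
    have "\<bar>g k s\<bar> \<le> 2 * B" for s
      unfolding g_def using B[of "s + u \<bullet> x k"] B[of s] by linarith
    then show "bounded (range (g k))" by (auto simp: bounded_iff)
    show "(\<Sum>j\<in>insert k S. g j (w \<bullet> x j)) = 0" for w
    proof -
      have "(\<Sum>j\<in>insert k (insert i S). g j (w \<bullet> x j)) = 0"
        unfolding g_def sum_subtractf
        using insert.prems(5)[of "w + u"] insert.prems(5)[of w]
        by (simp only: inner_add_left)
      moreover have "g i s = 0" for s by (simp add: g_def u)
      ultimately show ?thesis
        using insert.hyps insert.prems(1) by simp
    qed
  qed (use insert.prems in auto)
  then have "f k (s + h + h) - f k (s + h) = f k (s + h) - f k s" for s
    by (simp add: g_def u)
  then show ?case
    by (rule bounded_second_difference_zero[OF insert.prems(4)])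
qed

lemma AE_in_measure_support:
  fixes \<nu> :: "'a::second_countable_topology measure"
  assumes "sets \<nu> = sets borel"
  shows "AE z in \<nu>. z \<in> measure_support \<nu>"
proof -
  let ?F = "{U. open U \<and> emeasure \<nu> U = 0}"
  obtain G where G: "G \<subseteq> ?F" "countable G" "\<Union>G = \<Union>?F"
    using Lindelof[of ?F] by blast
  have "(\<Union>U\<in>G. U) \<in> null_sets \<nu>"
    by (rule null_sets_UN') (use G assms in \<open>auto simp: null_sets_def\<close>)
  then have "AE z in \<nu>. z \<notin> \<Union>?F"
    using G(3) AE_not_in by fastforce
  then show ?thesis
    by eventually_elim (auto simp: measure_support_def zero_less_iff_neq_zero)
qed

lemma gram_quadratic_form:
  fixes f :: "'i \<Rightarrow> 'b \<Rightarrow> 'a::real_inner"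
  assumes int: "\<And>i j. integrable M (\<lambda>z. f i z \<bullet> f j z)"
  shows "(\<Sum>i\<in>S. \<Sum>j\<in>S. v i * v j * (\<integral>z. f i z \<bullet> f j z \<partial>M))
           = (\<integral>z. (norm (\<Sum>i\<in>S. v i *\<^sub>R f i z))\<^sup>2 \<partial>M)"
    and "integrable M (\<lambda>z. (norm (\<Sum>i\<in>S. v i *\<^sub>R f i z))\<^sup>2)"
proof -
  have eq: "(norm (\<Sum>i\<in>S. v i *\<^sub>R f i z))\<^sup>2 = (\<Sum>i\<in>S. \<Sum>j\<in>S. v i * v j * (f i z \<bullet> f j z))" for z
    unfolding power2_norm_eq_inner inner_sum_left inner_sum_right
    by (subst sum.swap) (simp add: mult_ac)
  show "integrable M (\<lambda>z. (norm (\<Sum>i\<in>S. v i *\<^sub>R f i z))\<^sup>2)"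
    unfolding eq using int by simp
  show "(\<Sum>i\<in>S. \<Sum>j\<in>S. v i * v j * (\<integral>z. f i z \<bullet> f j z \<partial>M))
           = (\<integral>z. (norm (\<Sum>i\<in>S. v i *\<^sub>R f i z))\<^sup>2 \<partial>M)"
    unfolding eq using int by (simp add: Bochner_Integration.integral_sum)
qed

lemma lebesgue_positive_AE_zero:
  fixes F :: "'a::euclidean_space \<Rightarrow> real"
  assumes pos: "lebesgue_positive \<nu>" and sets: "sets \<nu> = sets borel"
    and cont: "continuous_on UNIV F" and AE: "AE w in \<nu>. F w = 0"
  shows "F w = 0"
proof (rule ccontr)
  assume ne: "F w \<noteq> 0"
  let ?U = "{w. F w \<noteq> 0}"
  have "open ?U"
    using cont by (intro open_Collect_neq) auto
  then have U: "?U \<in> sets borel" by simp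
  have "emeasure \<nu> ?U = 0"
    using AE by (subst (asm) AE_iff_measurable[OF _ refl])
      (use U sets sets_eq_imp_space_eq[OF sets] in auto)
  then have "emeasure lborel ?U = 0"
    using pos U unfolding lebesgue_positive_def
    by (metis less_irrefl zero_less_iff_neq_zero)
  then have "negligible ?U"
    using U by (simp add: negligible_iff_emeasure0)
  then show False
    using open_not_negligible[OF \<open>open ?U\<close>] ne by blast
qed

theorem corollary1p4:
  fixes \<alpha> :: real and \<sigma> :: "real \<Rightarrow> real"
    and x :: "'m::finite \<Rightarrow> real ^ 'd" and y :: "'m \<Rightarrow> real"
    and \<mu>\<^sub>0 :: "(real \<times> (real ^ 'd)) measure"
  assumes "\<alpha> > 0"
    and "C2_bounded \<sigma>"
    and "prob_space \<mu>\<^sub>0" and "sets \<mu>\<^sub>0 = sets borel"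
    and mean_zero: "has_bochner_integral \<mu>\<^sub>0 (\<lambda>z. z) 0"
    and "compact (measure_support (distr \<mu>\<^sub>0 borel fst))"
    and "integrable \<mu>\<^sub>0 (\<lambda>(c, w). norm w)"
    and "non_polynomial \<sigma>"
    and "slowly_increasing \<sigma>"
    and "lebesgue_positive (distr \<mu>\<^sub>0 borel snd)"
    and "distinct_directions x"
  shows "positive_definite (kernel_matrix \<alpha> \<sigma> \<mu>\<^sub>0 x)"
proof -
  interpret prob_space \<mu>\<^sub>0 by fact
  have borel_meas: "f \<in> borel_measurable \<mu>\<^sub>0" if "continuous_on UNIV f"
    for f :: "real \<times> (real ^ 'd) \<Rightarrow> 'z::topological_space"
    using borel_measurable_continuous_onI[OF that]
    by (simp add: measurable_cong_sets[OF assms(4) refl])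
  have fst_meas: "fst \<in> borel_measurable \<mu>\<^sub>0" and snd_meas: "snd \<in> borel_measurable \<mu>\<^sub>0"
    by (intro borel_meas continuous_intros)+

  have cont: "continuous_on UNIV \<sigma>" and cont': "continuous_on UNIV (deriv \<sigma>)"
    using assms(2) unfolding C2_bounded_def
    by (auto intro!: continuous_at_imp_continuous_on differentiable_imp_continuous_within)
  obtain B where B: "\<And>t. \<bar>\<sigma> t\<bar> \<le> B"
    using assms(2) by (auto simp: C2_bounded_def bounded_iff)
  obtain B' where B': "\<And>t. \<bar>deriv \<sigma> t\<bar> \<le> B'"
    using assms(2) by (auto simp: C2_bounded_def bounded_iff)
  obtain K where K: "\<And>c. c \<in> measure_support (distr \<mu>\<^sub>0 borel fst) \<Longrightarrow> \<bar>c\<bar> \<le> K"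
    using compact_imp_bounded[OF assms(6)] by (auto simp: bounded_iff)
  have AE_c: "AE z in \<mu>\<^sub>0. \<bar>fst z\<bar> \<le> K"
    using AE_distrD[OF fst_meas AE_in_measure_support[of "distr \<mu>\<^sub>0 borel fst"]]
    by (auto intro: K)

  define f where "f i z = \<sigma> (snd z \<bullet> x i)" for i and z :: "real \<times> (real ^ 'd)"
  define g where "g i z = (fst z * deriv \<sigma> (snd z \<bullet> x i)) *\<^sub>R x i" for i and z :: "real \<times> (real ^ 'd)"

  have f_int: "integrable \<mu>\<^sub>0 (\<lambda>z. f i z \<bullet> f j z)" for i j
  proof (rule integrable_const_bound[where B = "B * B"])
    have "\<bar>\<sigma> s\<bar> * \<bar>\<sigma> t\<bar> \<le> B * B" for s t
      using B[of s] B[of t] by (intro mult_mono) auto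
    then show "AE z in \<mu>\<^sub>0. norm (f i z \<bullet> f j z) \<le> B * B"
      by (simp add: f_def abs_mult)
    show "(\<lambda>z. f i z \<bullet> f j z) \<in> borel_measurable \<mu>\<^sub>0"
      unfolding f_def
      by (intro borel_meas continuous_intros continuous_on_compose2[OF cont]) auto
  qed
  have g_int: "integrable \<mu>\<^sub>0 (\<lambda>z. g i z \<bullet> g j z)" for i j
  proof (rule integrable_const_bound[where B = "(K * B' * norm (x i)) * (K * B' * norm (x j))"])
    show "AE z in \<mu>\<^sub>0. norm (g i z \<bullet> g j z) \<le> (K * B' * norm (x i)) * (K * B' * norm (x j))"
      using AE_c
    proof eventually_elim
      case (elim z)
      have bd: "norm (g l z) \<le> K * B' * norm (x l)" for l
        using elim B'[of "snd z \<bullet> x l"] unfolding g_def norm_scaleR abs_mult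
        by (intro mult_right_mono mult_mono) auto
      have "norm (g i z \<bullet> g j z) \<le> norm (g i z) * norm (g j z)"
        by (simp add: Cauchy_Schwarz_ineq2)
      also have "\<dots> \<le> (K * B' * norm (x i)) * (K * B' * norm (x j))"
        by (intro mult_mono bd order_trans[OF norm_ge_zero bd]) auto
      finally show ?case .
    qed
    show "(\<lambda>z. g i z \<bullet> g j z) \<in> borel_measurable \<mu>\<^sub>0"
      unfolding g_def
      by (intro borel_meas continuous_intros continuous_on_compose2[OF cont']) auto
  qed

  have entry: "kernel_matrix \<alpha> \<sigma> \<mu>\<^sub>0 x $ i $ j = \<alpha> / CARD('m) *
      ((\<integral>z. f i z \<bullet> f j z \<partial>\<mu>\<^sub>0) + (\<integral>z. g i z \<bullet> g j z \<partial>\<mu>\<^sub>0))" for i j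
    by (simp add: kernel_matrix_def f_def g_def case_prod_beta' power2_eq_square algebra_simps)
  have quad: "v \<bullet> (kernel_matrix \<alpha> \<sigma> \<mu>\<^sub>0 x *v v) = \<alpha> / CARD('m) *
      ((\<integral>z. (norm (\<Sum>i\<in>UNIV. v $ i *\<^sub>R f i z))\<^sup>2 \<partial>\<mu>\<^sub>0) +
       (\<integral>z. (norm (\<Sum>i\<in>UNIV. v $ i *\<^sub>R g i z))\<^sup>2 \<partial>\<mu>\<^sub>0))" for v
    unfolding gram_quadratic_form(1)[where f = f, OF f_int, symmetric]
      gram_quadratic_form(1)[where f = g, OF g_int, symmetric]
    by (simp add: inner_vec_def matrix_vector_mult_def entry sum_distrib_left
        sum.distrib[symmetric] algebra_simps)

  have "v \<bullet> (kernel_matrix \<alpha> \<sigma> \<mu>\<^sub>0 x *v v) > 0" if "v \<noteq> 0" for v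
  proof -
    let ?F = "\<lambda>w. \<Sum>i\<in>UNIV. v $ i * \<sigma> (w \<bullet> x i)"
    let ?I = "\<integral>z. (norm (\<Sum>i\<in>UNIV. v $ i *\<^sub>R f i z))\<^sup>2 \<partial>\<mu>\<^sub>0"
    obtain k where k: "v $ k \<noteq> 0"
      using \<open>v \<noteq> 0\<close> by (auto simp: vec_eq_iff)
    have contF: "continuous_on UNIV ?F"
      by (intro continuous_intros continuous_on_compose2[OF cont]) auto
    have "?I \<noteq> 0"
    proof
      assume "?I = 0"
      then have "AE z in \<mu>\<^sub>0. ?F (snd z) = 0"
        using integral_nonneg_eq_0_iff_AE[OF gram_quadratic_form(2)[where f = f, OF f_int]]
        by (simp add: f_def)
      moreover have "{w. ?F w = 0} \<in> sets borel"
        by (intro borel_closed closed_Collect_eq contF continuous_intros)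
      ultimately have "AE w in distr \<mu>\<^sub>0 borel snd. ?F w = 0"
        by (subst AE_distr_iff[OF snd_meas]) auto
      then have F0: "?F w = 0" for w
        by (rule lebesgue_positive_AE_zero[OF assms(10) sets_distr contF])
      have "v $ k * \<sigma> (0 + t) = v $ k * \<sigma> 0" for t
      proof (rule sum_ridge_zero_imp_periodic[where S = "UNIV - {k}" and x = x
            and f = "\<lambda>i s. v $ i * \<sigma> s"])
        show "bounded (range (\<lambda>s. v $ k * \<sigma> s))"
          using bounded_scaling[of "range \<sigma>" "v $ k"] assms(2)
          by (simp add: C2_bounded_def image_image)
        show "(\<Sum>i\<in>insert k (UNIV - {k}). v $ i * \<sigma> (w \<bullet> x i)) = 0" for w
          using F0[of w] by (simp only: insert_Diff_single insert_UNIV)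
      qed (use assms(11) in \<open>auto simp: distinct_directions_def\<close>)
      then have "\<sigma> t = poly [:\<sigma> 0:] t" for t
        using k by simp
      then show False
        using assms(8) unfolding non_polynomial_def by blast
    qed
    moreover have "?I \<ge> 0" by simp
    moreover have "(\<integral>z. (norm (\<Sum>i\<in>UNIV. v $ i *\<^sub>R g i z))\<^sup>2 \<partial>\<mu>\<^sub>0) \<ge> 0" by simp
    ultimately have "?I + (\<integral>z. (norm (\<Sum>i\<in>UNIV. v $ i *\<^sub>R g i z))\<^sup>2 \<partial>\<mu>\<^sub>0) > 0" by linarith
    then show ?thesis
      unfolding quad using \<open>\<alpha> > 0\<close> by (intro mult_pos_pos) simp_all
  qed
  moreover have "transpose (kernel_matrix \<alpha> \<sigma> \<mu>\<^sub>0 x) = kernel_matrix \<alpha> \<sigma> \<mu>\<^sub>0 x"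
    by (simp add: transpose_def vec_eq_iff entry inner_commute mult.commute)
  ultimately show ?thesis
    unfolding positive_definite_def by blast
qed

end
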